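(* Consider the randomized gossip algorithm with unreliable communication on $n\ge 3$ nodes, with node pair selection matrix $A=[a_{ij}]$ and communication probabilities $\{P_k^+\}_{k\ge0},\{P_k^-\}_{k\ge0}$ (as defined in the context). Suppose that communication is independent, i.e. the events $\mathbb{E}_k^+$ and $\mathbb{E}_k^-$ are independent for all $k$, and that the number of nodes $n$ is odd. Assume that $P_k^+,P_k^-\in[0,1-\varepsilon]$ for all $k\ge0$, with $0<\varepsilon<1$ a fixed number. Then for any $k_0\ge0$ and for almost all initial conditions $x^0=x(k_0)\in\mathbb{R}^n$ (with respect to Lebesgue measure), we have $$\mathbf{P}\Big(\sum_{i=1}^n x_i(k)=n\,x_{\rm ave}\ \text{ for all } k\ge k_0\Big)=0$$ if the consensus limit $\xi$ exists, where $x_{\rm ave}=\frac1n\sum_{i=1}^n x_i(k_0)$.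
   Context: Network model. The node set is $\mathcal{V}=\{1,\dots,n\}$, $n\ge3$. $A=[a_{ij}]\in\mathbb{R}^{n\times n}$ is a stochastic matrix (nonnegative entries, each row sums to $1$). Node pair selection process. Independently at each time $k=0,1,2,\dots$, a node $i\in\mathcal{V}$ is drawn with probability $1/n$, and then node $i$ picks the (ordered) pair $(i,j)$ with probability $a_{ij}$. Node communication process. $\{P_k^+\}_{k\ge0}$ and $\{P_k^-\}_{k\ge0}$ are deterministic sequences in $[0,1]$. Independently over time, and independently of the node states and of the node pair selection process, $\mathbf{P}(\mathbb{E}_k^+)=P_k^+$ and $\mathbf{P}(\mathbb{E}_k^-)=P_k^-$, where $\mathbb{E}_k^+$ is the event that node $i$ receives $x_j(k)$ when $(i,j)$ is selected at time $k$, and $\mathbb{E}_k^-$ is the event that node $j$ receives $x_i(k)$ when $(i,j)$ is selected at time $k$. Algorithm. Let $k_0\ge0$ be an arbitrary integer initial time and $x(k_0)=x^0\in\mathbb{R}^n$ a deterministic initial condition. For $k\ge k_0$, $x_i(k+1)=\frac12x_i(k)+\frac12x_j(k)$ if $(i,j)$ or $(j,i)$ is selected at time $k$ and $i$ receives $x_j(k)$; otherwise $x_i(k+1)=x_i(k)$. Consensus limit. The consensus limit is a random variable $\xi=\xi(k_0,x^0)$ (when it exists) such that $\lim_{k\to\infty}x_i(k)=\xi$ almost surely for every $i=1,\dots,n$. *)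

theory Defs
  imports "HOL-Probability.Probability"
begin

definition stochastic_matrix :: "real^'n^'n \<Rightarrow> bool" where
  "stochastic_matrix A \<longleftrightarrow> (\<forall>i j. 0 \<le> A $ i $ j) \<and> (\<forall>i. (\<Sum>j\<in>UNIV. A $ i $ j) = 1)"

text \<open>
  The nodes are the elements of the finite type \<open>'n\<close>.  \<open>pair k\<close> is the ordered pair selected at
  time \<open>k\<close>; \<open>Eplus k\<close> and \<open>Eminus k\<close> are the events that the first, respectively second, node
  of that pair receives the state of the other one.

  Assumption \<open>indep\<close> says that all selections and all communication outcomes are mutually
  independent, over time and of each other.  The two events of one time step generate a single
  \<open>\<sigma>\<close>-algebra of the family, so their joint law given the marginals is left arbitrary.
  Independence of the node states needs no separate assumption: the state at time \<open>k\<close> is a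
  function of the deterministic initial condition and of the selections and communication
  outcomes before \<open>k\<close>.
\<close>

locale randomized_gossip = prob_space M
  for M :: "'w measure" +
  fixes A :: "real^'n^'n"
    and pair :: "nat \<Rightarrow> 'w \<Rightarrow> 'n \<times> 'n"
    and Eplus Eminus :: "nat \<Rightarrow> 'w set"
    and Pplus Pminus :: "nat \<Rightarrow> real"
  assumes stochastic: "stochastic_matrix A"
    and pair_measurable: "\<And>k. random_variable (count_space UNIV) (pair k)"
    and Eplus_event: "\<And>k. Eplus k \<in> events"
    and Eminus_event: "\<And>k. Eminus k \<in> events"
    and prob_pair: "\<And>k i j. prob {\<omega> \<in> space M. pair k \<omega> = (i, j)} = 1 / real CARD('n) * A $ i $ j"
    and prob_Eplus: "\<And>k. prob (Eplus k) = Pplus k"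
    and prob_Eminus: "\<And>k. prob (Eminus k) = Pminus k"
    and indep: "indep_sets
          (case_sum (\<lambda>k. sets (vimage_algebra (space M) (pair k) (count_space UNIV)))
                    (\<lambda>k. sigma_sets (space M) {Eplus k, Eminus k}))
          (UNIV :: (nat + nat) set)"

text \<open>
  One update of the state \<open>x\<close> when the ordered pair \<open>(p, q)\<close> is selected; \<open>rp\<close> and \<open>rq\<close> tell
  whether \<open>p\<close> receives from \<open>q\<close> and \<open>q\<close> from \<open>p\<close>.  A self-selection \<open>p = q\<close> changes nothing.
\<close>

definition gossip_step :: "'n \<times> 'n \<Rightarrow> bool \<Rightarrow> bool \<Rightarrow> real^'n \<Rightarrow> real^'n" where
  "gossip_step pq rp rq x = (case pq of (p, q) \<Rightarrow>
     (\<chi> i. if i = p \<and> rp then 1/2 * x $ i + 1/2 * x $ q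
           else if i = q \<and> rq then 1/2 * x $ i + 1/2 * x $ p
           else x $ i))"

text \<open>
  \<open>gossip_state pair Eplus Eminus k0 x0 k \<omega>\<close> is the state at time \<open>k \<ge> k0\<close> when started from
  \<open>x0\<close> at time \<open>k0\<close>; for \<open>k < k0\<close> it is the junk value \<open>x0\<close>.
\<close>

primrec gossip_state ::
  "(nat \<Rightarrow> 'w \<Rightarrow> 'n \<times> 'n) \<Rightarrow> (nat \<Rightarrow> 'w set) \<Rightarrow> (nat \<Rightarrow> 'w set)
     \<Rightarrow> nat \<Rightarrow> real^'n \<Rightarrow> nat \<Rightarrow> 'w \<Rightarrow> real^'n" where
  "gossip_state pair Eplus Eminus k0 x0 0 \<omega> = x0"
| "gossip_state pair Eplus Eminus k0 x0 (Suc k) \<omega> =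
     (if k < k0 then x0
      else gossip_step (pair k \<omega>) (\<omega> \<in> Eplus k) (\<omega> \<in> Eminus k)
             (gossip_state pair Eplus Eminus k0 x0 k \<omega>))"

definition consensus_limit :: "'w measure \<Rightarrow> (nat \<Rightarrow> 'w \<Rightarrow> real^'n) \<Rightarrow> ('w \<Rightarrow> real) \<Rightarrow> bool" where
  "consensus_limit M X \<xi> \<longleftrightarrow>
     \<xi> \<in> borel_measurable M \<and> (\<forall>i. AE \<omega> in M. (\<lambda>k. X k \<omega> $ i) \<longlonglongrightarrow> \<xi> \<omega>)"

definition average :: "real^'n \<Rightarrow> real" where
  "average x = 1 / real CARD('n) * (\<Sum>i\<in>UNIV. x $ i)"

context randomized_gossip
begin

lemma gossip_state_measurable:
  "gossip_state pair Eplus Eminus k0 x0 k \<in> borel_measurable M"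
proof (induction k)
  case 0
  show ?case by simp
next
  case (Suc k)
  have [measurable]: "pair k \<in> measurable M (count_space UNIV)" "Eplus k \<in> events" "Eminus k \<in> events"
    using pair_measurable Eplus_event Eminus_event by auto
  have step: "gossip_step pq rp rq \<in> borel_measurable borel" for pq :: "'n \<times> 'n" and rp rq
  proof -
    obtain p q where pq: "pq = (p, q)" by (cases pq)
    have "continuous_on UNIV (\<lambda>x::real^'n. if i = p \<and> rp then 1/2 * x $ i + 1/2 * x $ q
        else if i = q \<and> rq then 1/2 * x $ i + 1/2 * x $ p else x $ i)" for i
      by (cases "i = p \<and> rp"; cases "i = q \<and> rq")
         (auto intro!: continuous_intros)
    then have "continuous_on UNIV (gossip_step pq rp rq)"
      unfolding gossip_step_def pq prod.case by (intro continuous_on_vec_lambda)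
    then show ?thesis by (rule borel_measurable_continuous_onI)
  qed
  have "(\<lambda>\<omega>. gossip_step (pair k \<omega>) (\<omega> \<in> Eplus k) (\<omega> \<in> Eminus k)
             (gossip_state pair Eplus Eminus k0 x0 k \<omega>)) \<in> borel_measurable M"
  proof (rule measurable_compose_countable'[where I = UNIV and g = "pair k"])
    show "(\<lambda>\<omega>. gossip_step pq (\<omega> \<in> Eplus k) (\<omega> \<in> Eminus k)
             (gossip_state pair Eplus Eminus k0 x0 k \<omega>)) \<in> borel_measurable M" for pq
    proof -
      have "(\<lambda>\<omega>. if \<omega> \<in> Eplus k
               then if \<omega> \<in> Eminus k then gossip_step pq True True (gossip_state pair Eplus Eminus k0 x0 k \<omega>)
                    else gossip_step pq True False (gossip_state pair Eplus Eminus k0 x0 k \<omega>)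
               else if \<omega> \<in> Eminus k then gossip_step pq False True (gossip_state pair Eplus Eminus k0 x0 k \<omega>)
                    else gossip_step pq False False (gossip_state pair Eplus Eminus k0 x0 k \<omega>))
            \<in> borel_measurable M"
        using measurable_compose[OF Suc step] by measurable
      then show ?thesis
        by (rule measurable_cong[THEN iffD1, rotated]) auto
    qed
  qed (auto intro: countable_finite)
  then show ?case by (cases "k < k0") simp_all
qed

lemma sum_preserved_event:
  "{\<omega> \<in> space M. \<forall>k\<ge>k0.
      (\<Sum>i\<in>UNIV. gossip_state pair Eplus Eminus k0 x0 k \<omega> $ i) = c} \<in> events"
proof -
  have "(\<lambda>\<omega>. gossip_state pair Eplus Eminus k0 x0 k \<omega> $ i) \<in> borel_measurable M" for k i
    by (rule measurable_compose[OF gossip_state_measurable])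
       (intro borel_measurable_continuous_onI continuous_intros)
  note [measurable] = this
  show ?thesis by measurable
qed

end

end

theory Submission imports Defs begin

text \<open>
  A step changes the sum of the states exactly when two nodes with different values are selected
  and only one of them receives.  Given that such a pair is selected and at least one of its nodes
  receives, this has conditional probability at least \<open>\<epsilon>\<close>; hence the process that is multiplied
  by \<open>1 / (1 - \<epsilon>)\<close> at each two-way exchange of different values, and killed at a one-way exchange,
  is a nonnegative supermartingale, and almost surely it does not become unbounded.  On the other
  hand, if the sum is preserved and the states converge to consensus, then infinitely many
  exchanges of different values happen, unless all nodes hold \<open>x\<^sub>a\<^sub>v\<^sub>e\<close> after finitely many steps.
  The latter puts \<open>x\<^sup>0\<close> on one of countably many hyperplanes: states are dyadic linear combinations
  of the initial values, and \<open>1/n\<close> is not dyadic for odd \<open>n\<close>.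
\<close>

section \<open>States as functions of the history of outcomes\<close>

text \<open>Histories are listed with the most recent outcome first.\<close>

primrec history_state :: "real^'n \<Rightarrow> (('n \<times> 'n) \<times> bool \<times> bool) list \<Rightarrow> real^'n" where
  "history_state x0 [] = x0"
| "history_state x0 (e # h) =
     (case e of (pq, a, b) \<Rightarrow> gossip_step pq a b (history_state x0 h))"

text \<open>The negation is an exchange of different values: at least one node of the pair receives
  and moves. Self-selections fall under the first disjunct.\<close>

definition idle :: "real^'n \<Rightarrow> ('n \<times> 'n) \<times> bool \<times> bool \<Rightarrow> bool" where
  "idle x e \<longleftrightarrow> (case e of ((p, q), a, b) \<Rightarrow> x $ p = x $ q \<or> (\<not> a \<and> \<not> b))"

text \<open>This is the supermartingale, later used with \<open>\<delta> = 1 - \<epsilon>\<close>.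
  Each factor is judged at the state before the outcome \<open>e\<close>, and the value 0 is
  absorbing.\<close>

primrec potential :: "real \<Rightarrow> real^'n \<Rightarrow> (('n \<times> 'n) \<times> bool \<times> bool) list \<Rightarrow> real" where
  "potential \<delta> x0 [] = 1"
| "potential \<delta> x0 (e # h) = potential \<delta> x0 h *
     (if idle (history_state x0 h) e then 1
      else case e of (pq, a, b) \<Rightarrow> if a \<and> b then 1 / \<delta> else 0)"

lemma potential_nonneg: "0 \<le> \<delta> \<Longrightarrow> 0 \<le> potential \<delta> x0 h"
  by (induction h) (auto split: prod.split)

lemma gossip_step_idle:
  assumes "idle x (pq, a, b)"
  shows "gossip_step pq a b x = x"
  using assms by (auto simp: gossip_step_def idle_def vec_eq_iff split: prod.splits)

text \<open>Only the receiver moves, and it moves half the way to the sender, so the sum shifts by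
  half of a nonzero difference.\<close>

lemma sum_gossip_step_one_way:
  assumes "\<not> idle x (pq, a, b)" and "a \<noteq> b"
  shows "(\<Sum>i\<in>UNIV. gossip_step pq a b x $ i) \<noteq> (\<Sum>i\<in>UNIV. x $ i)"
proof -
  obtain p q where pq: "pq = (p, q)" by (cases pq)
  have ne: "x $ p \<noteq> x $ q" using assms(1) by (auto simp: idle_def pq)
  \<comment> \<open>\<open>r\<close> is the only receiver and \<open>s\<close> the sender; this
    merges the two cases of \<open>a \<noteq> b\<close>.\<close>
  define r s where "r = (if a then p else q)" and "s = (if a then q else p)"
  have ne': "x $ r \<noteq> x $ s" using ne by (auto simp: r_def s_def)
  have "gossip_step pq a b x $ i = x $ i + (if i = r then (x $ s - x $ r) / 2 else 0)" for i
    using ne assms(2) by (auto simp: gossip_step_def pq r_def s_def field_simps)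
  then have "(\<Sum>i\<in>UNIV. gossip_step pq a b x $ i) = (\<Sum>i\<in>UNIV. x $ i) + (x $ s - x $ r) / 2"
    by (simp add: sum.distrib)
  then show ?thesis using ne' by simp
qed

section \<open>Dyadic combinations of the initial values\<close>

text \<open>The coefficients are \<open>z $ j / 2 ^ m\<close>. Writing them with integers and one
  common denominator lets the witnesses range over countable types.\<close>

definition dyadic_combination :: "real^'n \<Rightarrow> real \<Rightarrow> bool" where
  "dyadic_combination x0 y \<longleftrightarrow>
     (\<exists>(z::int^'n) m::nat. 2 ^ m * y = (\<Sum>j\<in>UNIV. of_int (z $ j) * x0 $ j))"

lemma dyadic_combination_midpoint:
  assumes "dyadic_combination x0 u" and "dyadic_combination x0 v"
  shows "dyadic_combination x0 (1/2 * u + 1/2 * v)"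
proof -
  obtain z m where u: "2 ^ m * u = (\<Sum>j\<in>UNIV. of_int (z $ j) * x0 $ j)"
    using assms(1) unfolding dyadic_combination_def by blast
  obtain z' m' where v: "2 ^ m' * v = (\<Sum>j\<in>UNIV. of_int (z' $ j) * x0 $ j)"
    using assms(2) unfolding dyadic_combination_def by blast
  \<comment> \<open>\<open>m + m'\<close> gives a common denominator, and the extra 1 absorbs the
    two halves.\<close>
  have "2 ^ (m + m' + 1) * (1/2 * u + 1/2 * v) = 2 ^ m' * (2 ^ m * u) + 2 ^ m * (2 ^ m' * v)"
    by (simp add: power_add algebra_simps)
  also have "\<dots> = (\<Sum>j\<in>UNIV. of_int ((\<chi> j. 2 ^ m' * z $ j + 2 ^ m * z' $ j) $ j) * x0 $ j)"
    unfolding u v by (simp add: sum_distrib_left sum.distrib algebra_simps)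
  finally show ?thesis unfolding dyadic_combination_def by blast
qed

lemma dyadic_combination_initial: "dyadic_combination x0 (x0 $ i)"
proof -
  have "2 ^ 0 * x0 $ i = (\<Sum>j\<in>UNIV. of_int ((\<chi> j. if j = i then 1 else 0) $ j) * x0 $ j)"
    by (simp add: if_distrib[of of_int] if_distribR cong: if_cong)
       (simp add: if_distrib[of "\<lambda>c. c * _"] cong: if_cong)
  then show ?thesis unfolding dyadic_combination_def by blast
qed

lemma dyadic_combination_history_state: "dyadic_combination x0 (history_state x0 h $ i)"
proof (induction h arbitrary: i)
  case Nil
  show ?case by (simp add: dyadic_combination_initial)
next
  case (Cons e h)
  then show ?case
    using dyadic_combination_midpoint[of x0 "history_state x0 h $ _" "history_state x0 h $ _"]
    by (auto simp: gossip_step_def split: prod.split)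
qed

text \<open>For fixed \<open>z\<close> and \<open>m\<close> the equation defines a hyperplane
  through the origin, which is a null set, and there are countably many such pairs.\<close>

lemma AE_average_not_dyadic:
  assumes "CARD('n) \<ge> 3" and "odd CARD('n)"
  shows "AE x0::real^'n in lebesgue. \<not> dyadic_combination x0 (average x0)"
proof -
  let ?n = "CARD('n)"
  have "AE x0::real^'n in lebesgue.
      2 ^ m * average x0 \<noteq> (\<Sum>j\<in>UNIV. of_int (z $ j) * x0 $ j)" for z :: "int^'n" and m :: nat
  proof -
    \<comment> \<open>Normal vector obtained by multiplying the equation by \<open>CARD('n)\<close>
      and comparing the coefficients of \<open>x $ j\<close>.\<close>
    define a :: "real^'n" where "a = (\<chi> j. real ?n * of_int (z $ j) - 2 ^ m)"
    have "a \<noteq> 0"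
    proof
      assume "a = 0"
      then have "real ?n * of_int (z $ j) = 2 ^ m" for j
        by (simp add: a_def vec_eq_iff)
      then have "real_of_int (int ?n * z $ j) = real_of_int (2 ^ m)" for j
        by simp
      then have "int ?n * z $ j = 2 ^ m" for j
        using of_int_eq_iff by blast
      \<comment> \<open>An odd divisor of a power of two is a unit, contradicting
        \<open>CARD('n) \<ge> 3\<close>.\<close>
      then have "int ?n dvd 2 ^ m" by (metis dvd_triv_left)
      moreover have "coprime (int ?n) (2 ^ m)" using assms(2) by simp
      ultimately have "is_unit (int ?n)" by (metis coprime_absorb_left)
      then show False using assms(1) by simp
    qed
    then have "AE x in lebesgue. x \<notin> {x. a \<bullet> x = 0}"
      by (intro AE_not_in) (simp add: negligible_hyperplane flip: negligible_iff_null_sets)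
    then show ?thesis
    proof (rule eventually_mono)
      fix x :: "real^'n" assume x: "x \<notin> {x. a \<bullet> x = 0}"
      have "a \<bullet> x = real ?n * (\<Sum>j\<in>UNIV. of_int (z $ j) * x $ j) - 2 ^ m * (\<Sum>j\<in>UNIV. x $ j)"
        by (simp add: inner_vec_def a_def algebra_simps sum_subtractf sum_distrib_left
            sum_distrib_right)
      also have "\<dots> = real ?n * ((\<Sum>j\<in>UNIV. of_int (z $ j) * x $ j) - 2 ^ m * average x)"
        by (simp add: average_def algebra_simps)
      finally show "2 ^ m * average x \<noteq> (\<Sum>j\<in>UNIV. of_int (z $ j) * x $ j)"
        using x by auto
    qed
  qed
  then show ?thesis unfolding dyadic_combination_def by (simp add: AE_all_countable)
qed

section \<open>Independence of the outcomes\<close>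

context randomized_gossip
begin

definition outcome :: "nat \<Rightarrow> 'w \<Rightarrow> ('n \<times> 'n) \<times> bool \<times> bool" where
  "outcome j \<omega> = (pair j \<omega>, \<omega> \<in> Eplus j, \<omega> \<in> Eminus j)"

text \<open>The second argument counts steps after \<open>k0\<close>, so the recorded times are
  \<open>k0, ..., k0 + k - 1\<close>.\<close>

primrec history :: "nat \<Rightarrow> nat \<Rightarrow> 'w \<Rightarrow> (('n \<times> 'n) \<times> bool \<times> bool) list" where
  "history k0 0 \<omega> = []"
| "history k0 (Suc k) \<omega> = outcome (k0 + k) \<omega> # history k0 k \<omega>"

lemma gossip_state_history:
  "gossip_state pair Eplus Eminus k0 x0 (k0 + k) \<omega> = history_state x0 (history k0 k \<omega>)"
proof (induction k)
  case 0
  \<comment> \<open>At time \<open>k0\<close> the state is \<open>x0\<close> by the base equation if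
    \<open>k0 = 0\<close>, and by the branch \<open>k < k0\<close> of the recursion
    otherwise.\<close>
  show ?case by (cases k0) auto
qed (auto simp: outcome_def)

definition received :: "bool \<Rightarrow> bool \<Rightarrow> nat \<Rightarrow> 'w set" where
  "received a b j = {\<omega> \<in> space M. (\<omega> \<in> Eplus j) = a \<and> (\<omega> \<in> Eminus j) = b}"

text \<open>Places the four joint reception outcomes in the \<sigma>-algebra to which
  \<open>indep\<close> refers, without splitting the two events of one time step.\<close>

lemma received_sigma: "received a b j \<in> sigma_sets (space M) {Eplus j, Eminus j}"
proof -
  have sub: "{Eplus j, Eminus j} \<subseteq> Pow (space M)"
    using Eplus_event Eminus_event sets.sets_into_space by blast
  interpret S: sigma_algebra "space M" "sigma_sets (space M) {Eplus j, Eminus j}"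
    by (rule sigma_algebra_sigma_sets[OF sub])
  have *: "(if c then X else space M - X) \<in> sigma_sets (space M) {Eplus j, Eminus j}"
    if "X \<in> {Eplus j, Eminus j}" for X c
    using that by (auto intro: S.compl_sets)
  have "received a b j = (if a then Eplus j else space M - Eplus j) \<inter>
      (if b then Eminus j else space M - Eminus j)"
    using sub by (auto simp: received_def)
  then show ?thesis using *[of "Eplus j" a] *[of "Eminus j" b] by (simp add: S.Int)
qed

lemma received_event [measurable]: "received a b j \<in> events"
  using Eplus_event[of j] Eminus_event[of j] unfolding received_def by measurable

lemma pair_event [measurable]: "{\<omega> \<in> space M. pair j \<omega> = pq} \<in> events"
  using pair_measurable[of j] by measurable

text \<open>\<open>indep\<close> is applied to the index set \<open>J <+> J\<close>, whose left copy
  carries the selections and whose right copy the receptions. Intersecting with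
  \<open>space M\<close> gives the empty \<open>J\<close> its correct value 1.\<close>

lemma prob_pairs_received:
  assumes "finite J"
  shows "prob (space M \<inter> (\<Inter>j\<in>J. {\<omega> \<in> space M. pair j \<omega> = f j} \<inter> received (a j) (b j) j)) =
    (\<Prod>j\<in>J. prob {\<omega> \<in> space M. pair j \<omega> = f j} * prob (received (a j) (b j) j))"
proof (cases "J = {}")
  case True
  then show ?thesis by (simp add: prob_space)
next
  case False
  let ?A = "case_sum (\<lambda>j. {\<omega> \<in> space M. pair j \<omega> = f j}) (\<lambda>j. received (a j) (b j) j)"
  have "{\<omega> \<in> space M. pair j \<omega> = f j} \<in> sets (vimage_algebra (space M) (pair j) (count_space UNIV))" for j
    by (auto simp: sets_vimage_algebra2 intro!: exI[of _ "{f j}"])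
  then have "prob (\<Inter>j\<in>J <+> J. ?A j) = (\<Prod>j\<in>J <+> J. prob (?A j))"
    using assms False received_sigma by (intro indep_setsD[OF indep]) (auto split: sum.split)
  moreover have "space M \<inter> (\<Inter>j\<in>J. {\<omega> \<in> space M. pair j \<omega> = f j} \<inter> received (a j) (b j) j) = (\<Inter>j\<in>J <+> J. ?A j)"
  proof -
    have "(\<Inter>j\<in>J <+> J. ?A j) = (\<Inter>j\<in>J. ?A (Inl j)) \<inter> (\<Inter>j\<in>J. ?A (Inr j))"
      by (simp only: Plus_def INT_Un INT_extend_simps(10))
    moreover have "(\<Inter>j\<in>J. ?A (Inl j)) \<subseteq> space M" using False by auto
    ultimately show ?thesis by auto
  qed
  ultimately show ?thesis using assms by (simp add: prod.Plus prod.distrib)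
qed

lemma outcome_eq:
  "{\<omega> \<in> space M. outcome j \<omega> = (pq, a, b)} = {\<omega> \<in> space M. pair j \<omega> = pq} \<inter> received a b j"
  by (auto simp: outcome_def received_def)

lemma outcome_event [measurable]: "{\<omega> \<in> space M. outcome j \<omega> = e} \<in> events"
  by (cases e) (auto simp: outcome_eq)

lemma prob_outcome:
  "prob {\<omega> \<in> space M. outcome j \<omega> = (pq, a, b)} =
    prob {\<omega> \<in> space M. pair j \<omega> = pq} * prob (received a b j)"
proof -
  have "{\<omega> \<in> space M. outcome j \<omega> = (pq, a, b)} =
      space M \<inter> ({\<omega> \<in> space M. pair j \<omega> = pq} \<inter> received a b j)"
    by (auto simp: outcome_def received_def)
  then show ?thesis using prob_pairs_received[of "{j}" "\<lambda>_. pq" "\<lambda>_. a" "\<lambda>_. b"] by simp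
qed

lemma prob_outcomes:
  assumes "finite J"
  shows "prob {\<omega> \<in> space M. \<forall>j\<in>J. outcome j \<omega> = f j} =
    (\<Prod>j\<in>J. prob {\<omega> \<in> space M. outcome j \<omega> = f j})"
proof -
  define g a b where "g j = fst (f j)" and "a j = fst (snd (f j))" and "b j = snd (snd (f j))" for j
  have f: "f j = (g j, a j, b j)" for j by (simp add: g_def a_def b_def)
  have "{\<omega> \<in> space M. \<forall>j\<in>J. outcome j \<omega> = f j} =
      space M \<inter> (\<Inter>j\<in>J. {\<omega> \<in> space M. pair j \<omega> = g j} \<inter> received (a j) (b j) j)"
    by (auto simp: f outcome_def received_def)
  then show ?thesis using prob_pairs_received[OF assms] by (simp add: f prob_outcome)
qed

section \<open>Laws of finite histories\<close>

lemma length_history [simp]: "length (history k0 k \<omega>) = k"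
  by (induction k) auto

text \<open>Since the newest outcome comes first, the one of time \<open>j\<close> sits at position
  \<open>j - k0\<close> of the reversed list.\<close>

lemma history_eq_iff:
  "length h = k \<Longrightarrow>
    history k0 k \<omega> = h \<longleftrightarrow> (\<forall>j\<in>{k0..<k0 + k}. outcome j \<omega> = rev h ! (j - k0))"
proof (induction k arbitrary: h)
  case (Suc k)
  then obtain e h' where h: "h = e # h'" "length h' = k" by (cases h) auto
  have "{k0..<k0 + Suc k} = insert (k0 + k) {k0..<k0 + k}" by auto
  moreover have "rev h ! (j - k0) = rev h' ! (j - k0)" if "j \<in> {k0..<k0 + k}" for j
    using that h by (auto simp: nth_append)
  moreover have "rev h ! (k0 + k - k0) = e" using h by (simp add: nth_append)
  ultimately show ?case using Suc.IH[OF h(2)] h by auto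
qed simp

lemma prob_history:
  assumes "length h = k"
  shows "prob {\<omega> \<in> space M. history k0 k \<omega> = h} =
    (\<Prod>j\<in>{k0..<k0 + k}. prob {\<omega> \<in> space M. outcome j \<omega> = rev h ! (j - k0)})"
  using prob_outcomes[of "{k0..<k0 + k}" "\<lambda>j. rev h ! (j - k0)"]
  by (simp only: history_eq_iff[OF assms]) simp

lemma history_event [measurable]: "{\<omega> \<in> space M. history k0 k \<omega> = h} \<in> events"
proof (induction k arbitrary: h)
  case (Suc k)
  show ?case
  proof (cases h)
    case (Cons e h')
    have "{\<omega> \<in> space M. history k0 (Suc k) \<omega> = h} =
        {\<omega> \<in> space M. outcome (k0 + k) \<omega> = e} \<inter> {\<omega> \<in> space M. history k0 k \<omega> = h'}"
      by (auto simp: Cons)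
    then show ?thesis using Suc[of h'] by (auto simp del: history.simps)
  qed simp
qed (cases h; simp)

text \<open>The newest outcome is independent of the past. In this form the supermartingale argument
  needs only finite sums and no conditional expectations.\<close>

lemma prob_history_Cons:
  assumes "length h = k"
  shows "prob {\<omega> \<in> space M. history k0 (Suc k) \<omega> = e # h} =
    prob {\<omega> \<in> space M. history k0 k \<omega> = h} * prob {\<omega> \<in> space M. outcome (k0 + k) \<omega> = e}"
proof -
  have "{k0..<k0 + Suc k} = insert (k0 + k) {k0..<k0 + k}" by auto
  moreover have "rev (e # h) ! (j - k0) = rev h ! (j - k0)" if "j \<in> {k0..<k0 + k}" for j
    using that assms by (auto simp: nth_append)
  moreover have "rev (e # h) ! (k0 + k - k0) = e" using assms by (simp add: nth_append)
  ultimately show ?thesis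
    using prob_history[of "e # h" "Suc k"] prob_history[OF assms] assms
    by (simp del: history.simps rev.simps)
qed

section \<open>The supermartingale bound\<close>

lemma sum_prob_pair: "(\<Sum>pq\<in>UNIV. prob {\<omega> \<in> space M. pair j \<omega> = pq}) = 1"
proof -
  have "(\<Sum>pq\<in>UNIV. prob {\<omega> \<in> space M. pair j \<omega> = pq}) =
      prob (\<Union>pq\<in>UNIV. {\<omega> \<in> space M. pair j \<omega> = pq})"
    by (rule finite_measure_finite_Union[symmetric]) (auto simp: disjoint_family_on_def)
  also have "(\<Union>pq\<in>UNIV. {\<omega> \<in> space M. pair j \<omega> = pq}) = space M" by auto
  finally show ?thesis by (simp add: prob_space)
qed

lemma sum_prob_received:
  "prob (received True True j) + prob (received True False j) + prob (received False True j)
    + prob (received False False j) = 1"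
proof -
  have "(\<Sum>ab\<in>UNIV. prob (received (fst ab) (snd ab) j)) =
      prob (\<Union>ab\<in>UNIV. received (fst ab) (snd ab) j)"
    by (rule finite_measure_finite_Union[symmetric])
       (auto simp: disjoint_family_on_def received_event, auto simp: received_def)
  also have "(\<Union>ab\<in>UNIV. received (fst ab) (snd ab) j) = space M"
    by (auto simp: received_def)
  finally show ?thesis by (simp add: prob_space UNIV_Times_UNIV[symmetric] UNIV_bool
        del: UNIV_Times_UNIV)
qed

lemma finite_histories: "finite {h :: (('n \<times> 'n) \<times> bool \<times> bool) list. length h = k}"
  using finite_lists_length_eq[of "UNIV :: (('n \<times> 'n) \<times> bool \<times> bool) set" k] by simp

lemma potential_event:
  "{\<omega> \<in> space M. c \<le> potential \<delta> x0 (history k0 k \<omega>)} \<in> events"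
proof -
  have "{\<omega> \<in> space M. c \<le> potential \<delta> x0 (history k0 k \<omega>)} =
      (\<Union>h\<in>{h. length h = k \<and> c \<le> potential \<delta> x0 h}. {\<omega> \<in> space M. history k0 k \<omega> = h})"
    by auto
  also have "\<dots> \<in> events"
    by (intro sets.finite_UN finite_subset[OF _ finite_histories[of k]]) auto
  finally show ?thesis .
qed

text \<open>\<open>two_way\<close> bounds by \<open>\<delta>\<close> the conditional probability
  that both nodes receive, given that at least one does. Without the division it also covers a time
  at which almost surely nothing is received.\<close>

context
  fixes \<delta> :: real
  assumes pos: "0 < \<delta>"
    and two_way: "\<And>j. prob (received True True j) \<le>
      \<delta> * (prob (received True True j) + prob (received True False j) + prob (received False True j))"
begin

text \<open>The supermartingale inequality, given the past \<open>h\<close>. For a pair with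
  different values the expected factor is \<open>r True True / \<delta> + r False False\<close>,
  which \<open>two_way\<close> bounds by the total probability 1; for equal values the factor is
  constantly 1.\<close>

lemma potential_step:
  "(\<Sum>e\<in>UNIV. prob {\<omega> \<in> space M. outcome j \<omega> = e} * potential \<delta> x0 (e # h)) \<le> potential \<delta> x0 h"
proof -
  let ?x = "history_state x0 h"
  define c where "c e = (if idle ?x e then 1
      else case e of (pq, a, b) \<Rightarrow> if a \<and> b then 1 / \<delta> else 0)" for e
  define r where "r a b = prob (received a b j)" for a b
  \<comment> \<open>The outcome with both receptions is idle exactly when the two values agree, so
    the case split separates the two kinds of pairs.\<close>
  have pt: "(\<Sum>(a, b)\<in>UNIV. r a b * c (pq, a, b)) \<le> 1" for pq
  proof (cases "idle ?x (pq, True, True)")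
    case True
    then have "idle ?x (pq, a, b)" for a b by (auto simp: idle_def)
    then show ?thesis using sum_prob_received[of j]
      by (simp add: UNIV_Times_UNIV[symmetric] UNIV_bool c_def r_def del: UNIV_Times_UNIV)
  next
    case False
    then have "idle ?x (pq, a, b) \<longleftrightarrow> \<not> a \<and> \<not> b" for a b by (auto simp: idle_def split: prod.splits)
    then have "(\<Sum>(a, b)\<in>UNIV. r a b * c (pq, a, b)) = r True True / \<delta> + r False False"
      by (simp add: UNIV_Times_UNIV[symmetric] UNIV_bool c_def del: UNIV_Times_UNIV)
    also have "\<dots> \<le> (r True True + r True False + r False True) + r False False"
      using two_way[of j] pos by (simp add: r_def field_simps)
    also have "\<dots> = 1" using sum_prob_received[of j] by (simp add: r_def)
    finally show ?thesis .
  qed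
  have "(\<Sum>e\<in>UNIV. prob {\<omega> \<in> space M. outcome j \<omega> = e} * c e) =
      (\<Sum>pq\<in>UNIV. \<Sum>(a, b)\<in>UNIV. prob {\<omega> \<in> space M. outcome j \<omega> = (pq, a, b)} * c (pq, a, b))"
    by (simp add: sum.cartesian_product case_prod_unfold)
  also have "\<dots> = (\<Sum>pq\<in>UNIV. prob {\<omega> \<in> space M. pair j \<omega> = pq} * (\<Sum>(a, b)\<in>UNIV. r a b * c (pq, a, b)))"
    by (simp add: prob_outcome r_def sum_distrib_left case_prod_unfold mult.assoc)
  also have "\<dots> \<le> (\<Sum>pq\<in>UNIV. prob {\<omega> \<in> space M. pair j \<omega> = pq} * 1)"
    by (intro sum_mono mult_left_mono pt) simp
  also have "\<dots> = 1" by (simp add: sum_prob_pair)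
  finally have "potential \<delta> x0 h * (\<Sum>e\<in>UNIV. prob {\<omega> \<in> space M. outcome j \<omega> = e} * c e) \<le>
      potential \<delta> x0 h * 1"
    using pos by (intro mult_left_mono) (auto intro: potential_nonneg)
  then show ?thesis by (simp add: c_def sum_distrib_left mult_ac)
qed

text \<open>The sum is the expectation of the potential after \<open>k\<close> steps. Splitting off
  the newest outcome reduces the induction to \<open>potential_step\<close>.\<close>

lemma expected_potential:
  "(\<Sum>h | length h = k. prob {\<omega> \<in> space M. history k0 k \<omega> = h} * potential \<delta> x0 h) \<le> 1"
proof (induction k)
  case 0
  show ?case by (simp add: prob_space)
next
  case (Suc k)
  let ?L = "{h :: (('n \<times> 'n) \<times> bool \<times> bool) list. length h = k}"
  have L: "{h :: (('n \<times> 'n) \<times> bool \<times> bool) list. length h = Suc k} = (\<lambda>(h, e). e # h) ` (?L \<times> UNIV)"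
    by (auto simp: length_Suc_conv)
  have "(\<Sum>h | length h = Suc k. prob {\<omega> \<in> space M. history k0 (Suc k) \<omega> = h} * potential \<delta> x0 h) =
      (\<Sum>(h, e)\<in>?L \<times> UNIV. prob {\<omega> \<in> space M. history k0 (Suc k) \<omega> = e # h} * potential \<delta> x0 (e # h))"
    unfolding L by (subst sum.reindex) (auto simp: inj_on_def case_prod_unfold)
  also have "\<dots> = (\<Sum>h\<in>?L. \<Sum>e\<in>UNIV.
      prob {\<omega> \<in> space M. history k0 (Suc k) \<omega> = e # h} * potential \<delta> x0 (e # h))"
    by (rule sum.cartesian_product[symmetric])
  also have "\<dots> = (\<Sum>h\<in>?L. prob {\<omega> \<in> space M. history k0 k \<omega> = h} *
      (\<Sum>e\<in>UNIV. prob {\<omega> \<in> space M. outcome (k0 + k) \<omega> = e} * potential \<delta> x0 (e # h)))"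
    by (intro sum.cong refl)
       (simp add: prob_history_Cons sum_distrib_left mult.assoc del: history.simps potential.simps)
  also have "\<dots> \<le> (\<Sum>h\<in>?L. prob {\<omega> \<in> space M. history k0 k \<omega> = h} * potential \<delta> x0 h)"
    by (intro sum_mono mult_left_mono potential_step) simp
  also have "\<dots> \<le> 1" by (rule Suc.IH)
  finally show ?case .
qed

text \<open>Markov's inequality, carried out on the finitely many histories of length
  \<open>k\<close>.\<close>

lemma prob_potential_ge:
  assumes "0 < c"
  shows "prob {\<omega> \<in> space M. c \<le> potential \<delta> x0 (history k0 k \<omega>)} \<le> 1 / c"
proof -
  let ?H = "{h. length h = k \<and> c \<le> potential \<delta> x0 h}"
  have fin: "finite ?H" by (rule finite_subset[OF _ finite_histories[of k]]) auto
  have "{\<omega> \<in> space M. c \<le> potential \<delta> x0 (history k0 k \<omega>)} =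
      (\<Union>h\<in>?H. {\<omega> \<in> space M. history k0 k \<omega> = h})"
    by auto
  then have "prob {\<omega> \<in> space M. c \<le> potential \<delta> x0 (history k0 k \<omega>)} \<le>
      (\<Sum>h\<in>?H. prob {\<omega> \<in> space M. history k0 k \<omega> = h})"
    using fin by (simp add: finite_measure_subadditive_finite image_subset_iff)
  then have "c * prob {\<omega> \<in> space M. c \<le> potential \<delta> x0 (history k0 k \<omega>)} \<le>
      c * (\<Sum>h\<in>?H. prob {\<omega> \<in> space M. history k0 k \<omega> = h})"
    using assms by (intro mult_left_mono) auto
  also have "\<dots> \<le> (\<Sum>h\<in>?H. prob {\<omega> \<in> space M. history k0 k \<omega> = h} * potential \<delta> x0 h)"
    unfolding sum_distrib_left mult.commute[of c] by (intro sum_mono mult_left_mono) auto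
  also have "\<dots> \<le> (\<Sum>h | length h = k. prob {\<omega> \<in> space M. history k0 k \<omega> = h} * potential \<delta> x0 h)"
    using pos by (intro sum_mono2 finite_histories) (auto intro!: mult_nonneg_nonneg potential_nonneg)
  also have "\<dots> \<le> 1" by (rule expected_potential)
  finally show ?thesis using assms by (simp add: field_simps)
qed

end

section \<open>Paths that preserve the sum\<close>

lemma history_state_unfold:
  "history_state x0 (history k0 (Suc k) \<omega>) =
    gossip_step (pair (k0 + k) \<omega>) (\<omega> \<in> Eplus (k0 + k)) (\<omega> \<in> Eminus (k0 + k))
      (history_state x0 (history k0 k \<omega>))"
  by (simp add: outcome_def)

text \<open>A one-way exchange of different values would change the sum, so along such a path the
  potential is never killed.\<close>

lemma potential_preserved_step:
  assumes "\<And>k. (\<Sum>i\<in>UNIV. history_state x0 (history k0 k \<omega>) $ i) = s"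
  shows "potential \<delta> x0 (history k0 (Suc k) \<omega>) = potential \<delta> x0 (history k0 k \<omega>) *
    (if idle (history_state x0 (history k0 k \<omega>)) (outcome (k0 + k) \<omega>) then 1 else 1 / \<delta>)"
proof (cases "idle (history_state x0 (history k0 k \<omega>)) (outcome (k0 + k) \<omega>)")
  case False
  have "(\<omega> \<in> Eplus (k0 + k)) = (\<omega> \<in> Eminus (k0 + k))"
    using sum_gossip_step_one_way[OF False[unfolded outcome_def]]
      assms[of "Suc k"] assms[of k] unfolding history_state_unfold by metis
  with False show ?thesis by (auto simp: outcome_def idle_def split: prod.splits)
qed simp

lemma potential_preserved_incseq:
  assumes sum: "\<And>k. (\<Sum>i\<in>UNIV. history_state x0 (history k0 k \<omega>) $ i) = s"
    and \<delta>: "0 < \<delta>" "\<delta> \<le> 1"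
  shows "incseq (\<lambda>k. potential \<delta> x0 (history k0 k \<omega>))"
proof (rule incseq_SucI)
  fix k
  let ?V = "potential \<delta> x0 (history k0 k \<omega>)"
  have "0 \<le> ?V" using \<delta> by (intro potential_nonneg) simp
  then have "?V * 1 \<le> ?V *
      (if idle (history_state x0 (history k0 k \<omega>)) (outcome (k0 + k) \<omega>) then 1 else 1 / \<delta>)"
    using \<delta> by (intro mult_left_mono) auto
  then show "?V \<le> potential \<delta> x0 (history k0 (Suc k) \<omega>)"
    unfolding potential_preserved_step[OF sum, of \<delta>] by simp
qed

text \<open>Each exchange of different values contributes a factor \<open>1 / \<delta>\<close>, and
  there are infinitely many of them.\<close>

lemma potential_unbounded:
  fixes x0 :: "real^'n"
  assumes sum: "\<And>k. (\<Sum>i\<in>UNIV. history_state x0 (history k0 k \<omega>) $ i) = real CARD('n) * average x0"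
    and lim: "\<And>i. (\<lambda>k. history_state x0 (history k0 k \<omega>) $ i) \<longlonglongrightarrow> \<xi>"
    and generic: "\<not> dyadic_combination x0 (average x0)"
    and \<delta>: "0 < \<delta>" "\<delta> \<le> 1"
  shows "\<exists>k. (1 / \<delta>) ^ m \<le> potential \<delta> x0 (history k0 k \<omega>)"
proof -
  let ?x = "\<lambda>k. history_state x0 (history k0 k \<omega>)"
  let ?V = "\<lambda>k. potential \<delta> x0 (history k0 k \<omega>)"
  note step = potential_preserved_step[OF sum, of \<delta>]
  note mono = potential_preserved_incseq[OF sum \<delta>]
  \<comment> \<open>If all outcomes from \<open>k\<close> on were idle, the state would be frozen
    and every coordinate equal to its limit \<open>\<xi>\<close>. The preserved sum then gives
    \<open>\<xi> = average x0\<close>, so the average would be a coordinate of a reachable state and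
    hence dyadic.\<close>
  have active: "\<exists>j\<ge>k. \<not> idle (?x j) (outcome (k0 + j) \<omega>)" for k
  proof (rule ccontr)
    assume "\<not> ?thesis"
    then have idle: "idle (?x j) (outcome (k0 + j) \<omega>)" if "j \<ge> k" for j using that by blast
    have "?x j = ?x k" if "j \<ge> k" for j
      using that
    proof (induction j rule: dec_induct)
      case (step j)
      then show ?case
        using gossip_step_idle[OF idle[OF step(1), unfolded outcome_def]]
        unfolding history_state_unfold by simp
    qed simp
    then have "eventually (\<lambda>j. ?x j $ i = ?x k $ i) sequentially" for i
      unfolding eventually_sequentially by metis
    then have "(\<lambda>j. ?x j $ i) \<longlonglongrightarrow> ?x k $ i" for i
      by (rule tendsto_eventually)
    then have eq: "?x k $ i = \<xi>" for i using lim LIMSEQ_unique by blast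
    then have "average x0 = \<xi>" using sum[of k] by simp
    then show False using dyadic_combination_history_state[of x0 "history k0 k \<omega>"] generic eq by metis
  qed
  show "\<exists>k. (1 / \<delta>) ^ m \<le> ?V k"
  proof (induction m)
    case 0
    show ?case by (rule exI[of _ 0]) simp
  next
    case (Suc m)
    then obtain k where k: "(1 / \<delta>) ^ m \<le> ?V k" by blast
    obtain j where j: "j \<ge> k" "\<not> idle (?x j) (outcome (k0 + j) \<omega>)" using active by blast
    \<comment> \<open>The potential does not drop while waiting for the next exchange, at
      \<open>j\<close>, which supplies the missing factor.\<close>
    have "(1 / \<delta>) ^ m \<le> ?V j" using k incseqD[OF mono j(1)] by simp
    then have "(1 / \<delta>) ^ m * (1 / \<delta>) \<le> ?V j * (1 / \<delta>)" using \<delta> by (intro mult_right_mono) auto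
    then have "(1 / \<delta>) ^ Suc m \<le> ?V (Suc j)" using j(2) unfolding step by (simp add: mult.commute)
    then show ?case by blast
  qed
qed

section \<open>Probability zero under independent communication\<close>

lemma prob_two_way_le:
  assumes ind: "indep_event (Eplus j) (Eminus j)"
    and \<epsilon>: "0 < \<epsilon>" and P: "Pplus j \<le> 1 - \<epsilon>" "Pminus j \<le> 1 - \<epsilon>"
  shows "prob (received True True j) \<le> (1 - \<epsilon>) *
    (prob (received True True j) + prob (received True False j) + prob (received False True j))"
proof -
  let ?p = "Pplus j" and ?q = "Pminus j"
  have sub: "Eplus j \<subseteq> space M" "Eminus j \<subseteq> space M"
    using Eplus_event Eminus_event sets.sets_into_space by blast+
  have RT: "received True True j = Eplus j \<inter> Eminus j" using sub by (auto simp: received_def)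
  then have TT: "prob (received True True j) = ?p * ?q"
  proof -
    have "prob (\<Inter>c\<in>UNIV. case_bool (Eplus j) (Eminus j) c) =
        (\<Prod>c\<in>UNIV. prob (case_bool (Eplus j) (Eminus j) c))"
      using ind unfolding indep_event_def indep_events_def_alt by (rule indep_setsD) auto
    then show ?thesis
      unfolding RT by (simp add: UNIV_bool prob_Eplus prob_Eminus mult.commute Int_commute)
  qed
  have "received True False j = Eplus j - received True True j" using sub by (auto simp: received_def)
  then have TF: "prob (received True False j) = ?p - ?p * ?q"
    using Eplus_event Eminus_event TT by (simp add: finite_measure_Diff prob_Eplus RT)
  have "received False True j = Eminus j - received True True j" using sub by (auto simp: received_def)
  then have FT: "prob (received False True j) = ?q - ?p * ?q"
    using Eplus_event Eminus_event TT by (simp add: finite_measure_Diff prob_Eminus RT)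
  have p0: "0 \<le> ?p" and q0: "0 \<le> ?q" using prob_Eplus[of j] prob_Eminus[of j] measure_nonneg by metis+
  \<comment> \<open>The goal is \<open>?p * ?q \<le> (1 - \<epsilon>) * (?p + ?q - ?p * ?q)\<close>.
    The first two bounds add up to \<open>2 * ?p * ?q \<le> (1 - \<epsilon>) * (?p + ?q)\<close>,
    and the third gives \<open>(1 - \<epsilon>) * (?p * ?q) \<le> ?p * ?q\<close>.\<close>
  have "?p * ?q \<le> ?p * (1 - \<epsilon>)" "?p * ?q \<le> (1 - \<epsilon>) * ?q" "0 \<le> \<epsilon> * (?p * ?q)"
    using p0 q0 P \<epsilon> by (auto intro: mult_left_mono mult_right_mono)
  then show ?thesis unfolding TT TF FT by (simp add: algebra_simps)
qed

text \<open>Almost every path in the event reaches each level \<open>(1 / \<delta>) ^ m\<close> of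
  the potential, while Markov's inequality allows this only with probability
  \<open>\<delta> ^ m\<close>.\<close>

lemma prob_sum_preserved:
  fixes x0 :: "real^'n"
  assumes ind: "\<And>k. indep_event (Eplus k) (Eminus k)"
    and \<epsilon>: "0 < \<epsilon>" "\<epsilon> < 1"
    and P: "\<And>k. Pplus k \<le> 1 - \<epsilon>" "\<And>k. Pminus k \<le> 1 - \<epsilon>"
    and generic: "\<not> dyadic_combination x0 (average x0)"
    and consensus: "consensus_limit M (gossip_state pair Eplus Eminus k0 x0) \<xi>"
  shows "prob {\<omega> \<in> space M. \<forall>k\<ge>k0.
    (\<Sum>i\<in>UNIV. gossip_state pair Eplus Eminus k0 x0 k \<omega> $ i) = real CARD('n) * average x0} = 0"
    (is "prob ?S = 0")
proof -
  define \<delta> where "\<delta> = 1 - \<epsilon>"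
  have \<delta>: "0 < \<delta>" "\<delta> < 1" using \<epsilon> by (auto simp: \<delta>_def)
  have two_way: "prob (received True True j) \<le> \<delta> *
      (prob (received True True j) + prob (received True False j) + prob (received False True j))" for j
    unfolding \<delta>_def using ind \<epsilon>(1) P by (rule prob_two_way_le)
  let ?V = "\<lambda>k \<omega>. potential \<delta> x0 (history k0 k \<omega>)"
  have S: "?S \<in> events" by (rule sum_preserved_event)
  have sum: "(\<Sum>i\<in>UNIV. history_state x0 (history k0 k \<omega>) $ i) = real CARD('n) * average x0"
    if "\<omega> \<in> ?S" for \<omega> k
    using that by (simp flip: gossip_state_history)
  have conv: "AE \<omega> in M. \<forall>i. (\<lambda>k. history_state x0 (history k0 k \<omega>) $ i) \<longlonglongrightarrow> \<xi> \<omega>"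
  proof -
    have "AE \<omega> in M. \<forall>i. (\<lambda>k. gossip_state pair Eplus Eminus k0 x0 k \<omega> $ i) \<longlonglongrightarrow> \<xi> \<omega>"
      using consensus by (simp add: consensus_limit_def AE_all_countable)
    then show ?thesis
      by (rule eventually_mono)
         (auto simp flip: gossip_state_history simp: add.commute[of k0] intro: LIMSEQ_ignore_initial_segment)
  qed
  have bound: "prob ?S \<le> \<delta> ^ m" for m
  proof -
    let ?C = "\<lambda>k. {\<omega> \<in> space M. (1 / \<delta>) ^ m \<le> ?V k \<omega>}"
    have C: "?C k \<in> events" for k by (rule potential_event)
    have C_le: "prob (?C k) \<le> \<delta> ^ m" for k
      using prob_potential_ge[OF \<delta>(1) two_way, of "(1 / \<delta>) ^ m" x0 k0 k] \<delta>
      by (simp add: power_one_over)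
    \<comment> \<open>On \<open>?S\<close> the potential never decreases, so a level once reached
      stays reached. Continuity from below then replaces a maximal inequality.\<close>
    have "incseq (\<lambda>k. ?S \<inter> ?C k)"
    proof (rule incseq_SucI, rule subsetI)
      fix k \<omega> assume \<omega>: "\<omega> \<in> ?S \<inter> ?C k"
      have "incseq (\<lambda>k. ?V k \<omega>)"
        using sum[of \<omega>] \<omega> \<delta> by (intro potential_preserved_incseq) auto
      from incseq_SucD[OF this, of k] show "\<omega> \<in> ?S \<inter> ?C (Suc k)"
        using \<omega> by (auto simp del: history.simps)
    qed
    moreover have "range (\<lambda>k. ?S \<inter> ?C k) \<subseteq> events" using S C by blast
    ultimately have "(\<lambda>k. prob (?S \<inter> ?C k)) \<longlonglongrightarrow> prob (\<Union>k. ?S \<inter> ?C k)"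
      by (intro finite_Lim_measure_incseq)
    moreover have "prob (?S \<inter> ?C k) \<le> \<delta> ^ m" for k
      using finite_measure_mono[of "?S \<inter> ?C k" "?C k"] C[of k] C_le[of k] by fastforce
    ultimately have "prob (\<Union>k. ?S \<inter> ?C k) \<le> \<delta> ^ m"
      by (intro LIMSEQ_le_const2) auto
    moreover have "prob ?S \<le> prob (\<Union>k. ?S \<inter> ?C k)"
    proof (rule finite_measure_mono_AE)
      show "AE \<omega> in M. \<omega> \<in> ?S \<longrightarrow> \<omega> \<in> (\<Union>k. ?S \<inter> ?C k)"
        using conv
      proof (rule eventually_mono, intro impI)
        fix \<omega>
        assume lim: "\<forall>i. (\<lambda>k. history_state x0 (history k0 k \<omega>) $ i) \<longlonglongrightarrow> \<xi> \<omega>"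
          and \<omega>: "\<omega> \<in> ?S"
        have "\<exists>k. (1 / \<delta>) ^ m \<le> ?V k \<omega>"
          using sum[OF \<omega>] lim generic \<delta> by (intro potential_unbounded) auto
        then show "\<omega> \<in> (\<Union>k. ?S \<inter> ?C k)" using \<omega> by blast
      qed
      show "(\<Union>k. ?S \<inter> ?C k) \<in> events" using S C by blast
    qed
    ultimately show ?thesis by linarith
  qed
  have "(\<lambda>m. \<delta> ^ m) \<longlonglongrightarrow> 0" using \<delta> by (intro LIMSEQ_power_zero) auto
  then have "prob ?S \<le> 0" by (rule LIMSEQ_le_const) (use bound in blast)
  then show ?thesis using measure_nonneg[of M ?S] by linarith
qed

end

theorem theorem7:
  fixes M :: "'w measure"
    and A :: "real^'n^'n"
    and pair :: "nat \<Rightarrow> 'w \<Rightarrow> 'n \<times> 'n"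
    and Eplus Eminus :: "nat \<Rightarrow> 'w set"
    and Pplus Pminus :: "nat \<Rightarrow> real"
    and \<epsilon> :: real
    and k0 :: nat
  assumes "randomized_gossip M A pair Eplus Eminus Pplus Pminus"
    and "CARD('n) \<ge> 3"
    and "odd CARD('n)"
    and "\<And>k. prob_space.indep_event M (Eplus k) (Eminus k)"
    and "0 < \<epsilon>" and "\<epsilon> < 1"
    and "\<And>k. Pplus k \<in> {0..1 - \<epsilon>}"
    and "\<And>k. Pminus k \<in> {0..1 - \<epsilon>}"
  shows "AE x0 in lebesgue.
           (\<exists>\<xi>. consensus_limit M (gossip_state pair Eplus Eminus k0 x0) \<xi>) \<longrightarrow>
           measure M {\<omega> \<in> space M. \<forall>k\<ge>k0.
             (\<Sum>i\<in>UNIV. gossip_state pair Eplus Eminus k0 x0 k \<omega> $ i) = real CARD('n) * average x0} = 0"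
proof -
  interpret randomized_gossip M A pair Eplus Eminus Pplus Pminus by fact
  \<comment> \<open>The exceptional null set consists of the \<open>x0\<close> with dyadic average;
    it is the same for every \<open>k0\<close>.\<close>
  show ?thesis
    using AE_average_not_dyadic[OF assms(2,3)]
  proof (rule eventually_mono)
    fix x0 :: "real^'n"
    assume "\<not> dyadic_combination x0 (average x0)"
    then show "(\<exists>\<xi>. consensus_limit M (gossip_state pair Eplus Eminus k0 x0) \<xi>) \<longrightarrow>
       measure M {\<omega> \<in> space M. \<forall>k\<ge>k0.
         (\<Sum>i\<in>UNIV. gossip_state pair Eplus Eminus k0 x0 k \<omega> $ i) = real CARD('n) * average x0} = 0"
      using prob_sum_preserved[OF assms(4-6)] assms(7,8) by auto
  qed
qed

end
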